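(* Let $G$ be a finite group, let $H$ be a subgroup of $G$ with $H \neq L(H,\mathrm{Aut}(G))$, and let $p$ be the smallest prime dividing $|\mathrm{Aut}(G)|$. Then \[ \Pr(H,\mathrm{Aut}(G)) \leq \frac{(p-1)|L(H,\mathrm{Aut}(G))| + |H|}{p|H|} - \frac{|X_H|\,(|\mathrm{Aut}(G)| - p)}{p|H||\mathrm{Aut}(G)|}, \] where $X_H = \{x \in H : C_{\mathrm{Aut}(G)}(x) = \{I\}\}$ and $I$ is the identity automorphism of $G$.
   Context: For a subgroup $H$ of a finite group $G$ with automorphism group $\mathrm{Aut}(G)$: $\Pr(H,\mathrm{Aut}(G)) := \dfrac{|\{(x,\alpha)\in H\times \mathrm{Aut}(G) : \alpha(x)=x\}|}{|H||\mathrm{Aut}(G)|}$; $L(H,\mathrm{Aut}(G)) := \{x\in H : \alpha(x)=x \text{ for all } \alpha\in \mathrm{Aut}(G)\}$, which is a normal subgroup of $H$; and $C_{\mathrm{Aut}(G)}(x) := \{\alpha\in\mathrm{Aut}(G) : \alpha(x)=x\}$ for $x\in H$. *)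

theory Defs
  imports Complex_Main "HOL-Computational_Algebra.Primes" "HOL-Algebra.Bij"
begin

text \<open>
  Throughout, Aut(G) is the library's set \<open>auto G\<close>, the carrier of \<open>AutoGroup G\<close>.
  Its elements are extensional (undefined outside the carrier), so each automorphism of \<open>G\<close>
  is represented exactly once and \<open>card (auto G)\<close> is the order of the automorphism group.
\<close>

definition Pr_Aut :: "('a, 'b) monoid_scheme \<Rightarrow> 'a set \<Rightarrow> real" where
  "Pr_Aut G H =
     real (card {(x, \<alpha>) \<in> H \<times> auto G. \<alpha> x = x}) / (real (card H) * real (card (auto G)))"

definition L_Aut :: "('a, 'b) monoid_scheme \<Rightarrow> 'a set \<Rightarrow> 'a set" where
  "L_Aut G H = {x \<in> H. \<forall>\<alpha> \<in> auto G. \<alpha> x = x}"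

definition C_Aut :: "('a, 'b) monoid_scheme \<Rightarrow> 'a \<Rightarrow> ('a \<Rightarrow> 'a) set" where
  "C_Aut G x = {\<alpha> \<in> auto G. \<alpha> x = x}"

definition X_Aut :: "('a, 'b) monoid_scheme \<Rightarrow> 'a set \<Rightarrow> 'a set" where
  "X_Aut G H = {x \<in> H. C_Aut G x = {\<one>\<^bsub>AutoGroup G\<^esub>}}"

end

theory Submission
  imports Defs "HOL-Algebra.Group_Action"
begin

text \<open>
  Fix \<open>A = Aut(G)\<close>. Summing over the first coordinate, the number of pairs \<open>(x, \<alpha>)\<close> with
  \<open>\<alpha>(x) = x\<close> is \<open>\<Sum>x\<in>H. |C(x)|\<close>, where \<open>C(x)\<close> is the stabilizer of \<open>x\<close> in \<open>A\<close>. Three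
  kinds of summand occur. If \<open>x \<in> L\<close> then \<open>|C(x)| = |A|\<close>; if \<open>x \<in> X\<close> then \<open>|C(x)| = 1\<close>; and
  for every other \<open>x\<close> the stabilizer is a proper subgroup, so by Lagrange its index is a divisor
  of \<open>|A|\<close> exceeding \<open>1\<close>. Such a divisor has a prime factor, hence is at least \<open>p\<close>, and
  \<open>|C(x)| \<le> |A|/p\<close>. Since \<open>p\<close> divides \<open>|A|\<close>, the group \<open>A\<close> is nontrivial, so \<open>L\<close> and \<open>X\<close> are
  disjoint, and the sum is at most
  \[ |L| |A| + |X| + (|H| - |L| - |X|) |A|/p. \]
  Division by \<open>|H| |A|\<close> gives the bound.
\<close>

text \<open>
  The index of \<open>K\<close> divides the order of the group and is not \<open>1\<close>, so it has a prime factor;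
  that factor bounds the index from below and is itself at least \<open>p\<close>.
\<close>

lemma (in group) proper_subgroup_card_le:
  fixes p :: nat
  assumes fin: "finite (carrier G)"
    and K: "subgroup K G" "K \<noteq> carrier G"
    and p_min: "\<And>q::nat. prime q \<Longrightarrow> q dvd order G \<Longrightarrow> p \<le> q"
  shows "p * card K \<le> order G"
proof -
  let ?i = "card (rcosets K)"
  have index: "?i * card K = order G"
    using lagrange_finite[OF fin K(1)] .
  have "K \<subset> carrier G"
    using K subgroup.subset by blast
  then have "card K < order G"
    unfolding order_def using fin psubset_card_mono by blast
  with index have "?i \<noteq> 1" "?i \<noteq> 0"
    by (metis mult_1 nat_neq_iff, metis mult_0 not_less_zero)
  then obtain q where q: "prime q" "q dvd ?i"
    using prime_factor_nat by blast
  have "p \<le> q"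
    using q index by (intro p_min) (auto intro: dvd_mult2 simp flip: index)
  also have "q \<le> ?i"
    using q \<open>?i \<noteq> 0\<close> by (simp add: dvd_imp_le)
  finally show ?thesis
    using index by (metis mult_le_mono1)
qed

lemma finite_auto:
  assumes "finite (carrier G)"
  shows "finite (auto G)"
proof (rule finite_subset)
  show "auto G \<subseteq> carrier G \<rightarrow>\<^sub>E carrier G"
    by (auto simp: auto_def hom_def Bij_def PiE_def)
  show "finite (carrier G \<rightarrow>\<^sub>E carrier G)"
    using assms by (simp add: finite_PiE)
qed

lemma carrier_AutoGroup: "carrier (AutoGroup G) = auto G"
  by (simp add: AutoGroup_def)

lemma (in group) AutoGroup_action: "group_action (AutoGroup G) (carrier G) (\<lambda>\<alpha>. \<alpha>)"
proof -
  interpret B: group "BijGroup (carrier G)"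
    by (rule group_BijGroup)
  show ?thesis
    using B.canonical_inj_is_hom[OF subgroup_auto]
    by (simp add: group_action_def AutoGroup_def id_def)
qed

lemma (in group) subgroup_C_Aut:
  assumes "x \<in> carrier G"
  shows "subgroup (C_Aut G x) (AutoGroup G)"
  using group_action.stabilizer_subgroup[OF AutoGroup_action assms]
  by (simp add: stabilizer_def C_Aut_def carrier_AutoGroup)

lemma card_fixing_pairs:
  assumes "finite H" "finite (auto G)"
  shows "card {(x, \<alpha>) \<in> H \<times> auto G. \<alpha> x = x} = (\<Sum>x\<in>H. card (C_Aut G x))"
proof -
  have "{(x, \<alpha>) \<in> H \<times> auto G. \<alpha> x = x} = (SIGMA x:H. C_Aut G x)"
    by (auto simp: C_Aut_def)
  then show ?thesis
    using assms by (simp add: C_Aut_def)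
qed

text \<open>
  The hypothesis on the cardinality keeps the two kinds of extreme summands apart: an element
  of both sets would be fixed by every automorphism and only by the identity.
\<close>

lemma L_Aut_X_Aut_disjoint:
  assumes "card (auto G) > 1"
  shows "L_Aut G H \<inter> X_Aut G H = {}"
proof -
  have "C_Aut G x = auto G" if "x \<in> L_Aut G H" for x
    using that by (auto simp: L_Aut_def C_Aut_def)
  with assms show ?thesis
    by (auto simp: X_Aut_def)
qed

text \<open>
  The class-by-class count, multiplied by \<open>p\<close>. The complement of the two extreme classes is kept
  as a set so that the count stays free of truncated subtraction.
\<close>

lemma (in group) card_fixing_pairs_le:
  fixes p :: nat
  assumes fin: "finite (carrier G)" and H: "H \<subseteq> carrier G"
    and nontrivial: "card (auto G) > 1"
    and p_min: "\<And>q::nat. prime q \<Longrightarrow> q dvd card (auto G) \<Longrightarrow> p \<le> q"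
  shows "p * card {(x, \<alpha>) \<in> H \<times> auto G. \<alpha> x = x}
    \<le> p * card (L_Aut G H) * card (auto G) + p * card (X_Aut G H)
      + card (H - (L_Aut G H \<union> X_Aut G H)) * card (auto G)"
proof -
  define L where "L = L_Aut G H"
  define X where "X = X_Aut G H"
  define a where "a = card (auto G)"
  define c where "c x = card (C_Aut G x)" for x
  have finH: "finite H"
    using fin H finite_subset by blast
  have LX: "L \<subseteq> H" "X \<subseteq> H" "L \<inter> X = {}"
    using L_Aut_X_Aut_disjoint[OF nontrivial, of H]
    by (auto simp: L_def X_def L_Aut_def X_Aut_def)
  then have finLX: "finite L" "finite X"
    using finH finite_subset by blast+
  interpret A: group "AutoGroup G"
    by (rule AutoGroup)

  have in_L: "c x = a" if "x \<in> L" for x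
  proof -
    have "C_Aut G x = auto G"
      using that by (auto simp: L_def L_Aut_def C_Aut_def)
    then show ?thesis
      by (simp add: c_def a_def)
  qed
  have in_X: "c x = 1" if "x \<in> X" for x
    using that by (simp add: X_def X_Aut_def c_def)
  have elsewhere: "p * c x \<le> a" if x: "x \<in> H - (L \<union> X)" for x
  proof -
    have "C_Aut G x \<noteq> carrier (AutoGroup G)"
      using x by (auto simp: L_def L_Aut_def C_Aut_def carrier_AutoGroup)
    moreover have "subgroup (C_Aut G x) (AutoGroup G)"
      using x H by (intro subgroup_C_Aut) auto
    ultimately show ?thesis
      using A.proper_subgroup_card_le[of "C_Aut G x" p] p_min finite_auto[OF fin]
      by (simp add: order_def carrier_AutoGroup c_def a_def)
  qed

  have "sum c H = sum c (L \<union> X) + sum c (H - (L \<union> X))"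
    using LX finH by (metis Un_least add.commute sum.subset_diff)
  also have "sum c (L \<union> X) = sum c L + sum c X"
    using LX finLX by (simp add: sum.union_disjoint)
  finally have "p * sum c H = p * card L * a + p * card X + (\<Sum>x\<in>H - (L \<union> X). p * c x)"
    using in_L in_X by (simp add: sum_distrib_left algebra_simps)
  also have "\<dots> \<le> p * card L * a + p * card X + card (H - (L \<union> X)) * a"
    using sum_bounded_above[of "H - (L \<union> X)" "\<lambda>x. p * c x" a] elsewhere by simp
  finally show ?thesis
    using card_fixing_pairs[OF finH finite_auto[OF fin]]
    by (simp add: L_def X_def a_def c_def)
qed

theorem theorem2p3:
  fixes G :: "('a, 'b) monoid_scheme" and H :: "'a set" and p :: nat
  assumes "group G" and "finite (carrier G)"
    and "subgroup H G"
    and "H \<noteq> L_Aut G H"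
    and "prime p" and "p dvd card (auto G)"
    and "\<forall>q::nat. prime q \<and> q dvd card (auto G) \<longrightarrow> p \<le> q"
  shows "Pr_Aut G H \<le>
      ((real p - 1) * real (card (L_Aut G H)) + real (card H)) / (real p * real (card H))
      - real (card (X_Aut G H)) * (real (card (auto G)) - real p)
          / (real p * real (card H) * real (card (auto G)))"
proof -
  interpret group G
    by fact
  define L where "L = L_Aut G H"
  define X where "X = X_Aut G H"
  define N where "N = card {(x, \<alpha>) \<in> H \<times> auto G. \<alpha> x = x}"
  define n where "n = real (card H)"
  define a where "a = real (card (auto G))"

  have HG: "H \<subseteq> carrier G"
    using \<open>subgroup H G\<close> by (rule subgroup.subset)
  then have finH: "finite H"
    using assms(2) finite_subset by blast
  have "H \<noteq> {}"
    using subgroup.one_closed[OF \<open>subgroup H G\<close>] by blast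
  then have n: "n > 0"
    using finH by (simp add: n_def card_gt_0_iff)
  have "card (auto G) > 0"
    using id_in_auto finite_auto[OF assms(2)] by (auto simp: card_gt_0_iff)
  moreover from this have "p \<le> card (auto G)"
    using assms(6) by (simp add: dvd_imp_le)
  ultimately have nontrivial: "card (auto G) > 1" and a: "a > 0"
    using prime_gt_1_nat[OF \<open>prime p\<close>] by (auto simp: a_def)
  have p: "real p > 0"
    using \<open>prime p\<close> by (simp add: prime_gt_0_nat)

  have LX: "L \<union> X \<subseteq> H" "L \<inter> X = {}"
    using L_Aut_X_Aut_disjoint[OF nontrivial, of H]
    by (auto simp: L_def X_def L_Aut_def X_Aut_def)
  then have "card H = card L + card X + card (H - (L \<union> X))"
    using finH
    by (metis Un_infinite card_Diff_subset card_Un_disjoint card_mono finite_Un finite_subset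
        le_add_diff_inverse)
  then have rest: "real (card (H - (L \<union> X))) = n - real (card L) - real (card X)"
    by (simp add: n_def)

  have "p * N \<le> p * card L * card (auto G) + p * card X + card (H - (L \<union> X)) * card (auto G)"
    unfolding N_def L_def X_def
    using assms(7) by (intro card_fixing_pairs_le[OF assms(2) HG nontrivial]) auto
  then have "real p * real N
      \<le> real p * real (card L) * a + real p * real (card X) + real (card (H - (L \<union> X))) * a"
    unfolding a_def by (metis of_nat_add of_nat_le_iff of_nat_mult)
  then have bound: "real p * real N
      \<le> ((real p - 1) * real (card L) + n) * a - real (card X) * (a - real p)"
    by (simp add: rest algebra_simps)

  have "Pr_Aut G H = real p * real N / (real p * n * a)"
    using p by (simp add: Pr_Aut_def N_def n_def a_def)
  also have "\<dots> \<le> (((real p - 1) * real (card L) + n) * a - real (card X) * (a - real p))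
      / (real p * n * a)"
    using bound p n a by (intro divide_right_mono) auto
  also have "\<dots> = ((real p - 1) * real (card L) + n) / (real p * n)
      - real (card X) * (a - real p) / (real p * n * a)"
    using a by (simp add: diff_divide_distrib)
  finally show ?thesis
    by (simp add: L_def X_def n_def a_def)
qed

end
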